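(* For every $n\ge4$ the map $G':\mathcal M'\to Q$ defined in the context is bijective.
   Context: Let $n\ge4$ and $I=\{1,\dots,n\}$. If $n$ is even put $I_0=\{1,2,4,6,\dots,n\}$, $I_1=\{3,5,\dots,n-1\}$; if $n$ is odd put $I_0=\{3,5,\dots,n\}$, $I_1=\{1,2,4,6,\dots,n-1\}$. Let $V=\{(i,1),(i,3):i\in I_0\}\cup\{(j,0),(j,2):j\in I_1\}\cup\{(n-1,4)\}$ and let $i_a$ ($(i,a)\in V$) be commuting indeterminates. Let $\mathcal M$ be the set of monomials (nonnegative exponents) in the $i_a$. Put $F_i=i_1i_3$ ($i\in I_0$), $F_i=i_0i_2$ ($i\in I_1\setminus\{n-1\}$), $F_{n-1}=(n-1)_0(n-1)_2(n-1)_4$, and let $\mathcal M'\subset\mathcal M$ be the set of monomials not divisible by any $F_i$, $i\in I$. Let $Q=\bigoplus_{i=0}^n\mathbb Z\alpha_i$ (the root lattice of type $D_n^{(1)}$). Every $m\in\mathcal M$ has a unique expression with nonnegative integer exponents $$m=\prod_{i\in I}F_i^{a_i}\prod_{i\in I_0}i_1^{p_i}i_3^{q_i}\prod_{j\in I_1\setminus\{n-1\}}j_2^{p_j}j_0^{q_j}\cdot((n-1)_2(n-1)_4)^p((n-1)_0(n-1)_4)^q((n-1)_0(n-1)_2)^r\,(n-1)_0^s(n-1)_2^t(n-1)_4^u$$ such that each of the tuples $(p_i,q_i)$ ($i\in I\setminus\{n-1\}$), $(p,q,r)$, $(s,t,u)$, $(p,s)$, $(q,t)$, $(r,u)$ has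 at most one nonzero entry. Define $G:\mathcal M\to Q$ by $$G(m)=\sum_{i\in I\setminus\{n-1\}}(q_i-p_i)\alpha_i-p\,\alpha_0+q(\alpha_0+\alpha_{n-1}+\eta)+r\alpha_0+s(\alpha_0+\alpha_{n-1})-t\,\alpha_{n-1}+u\,\eta,$$ where $\eta=\alpha_{n-2}+\alpha_{n-1}+\alpha_n$ if $n>4$ and $\eta=\alpha_1+\alpha_2+\alpha_3+\alpha_4$ if $n=4$. Let $G'$ be the restriction of $G$ to $\mathcal M'$. *)

theory Defs
  imports "HOL-Library.Multiset" "HOL-Library.Poly_Mapping"
begin

definition I_set :: "nat \<Rightarrow> nat set" where
  "I_set n = {1..n}"

definition I0 :: "nat \<Rightarrow> nat set" where
  "I0 n = (if even n then {1} \<union> {i. 2 \<le> i \<and> i \<le> n \<and> even i}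
           else {i. 3 \<le> i \<and> i \<le> n \<and> odd i})"

definition I1 :: "nat \<Rightarrow> nat set" where
  "I1 n = (if even n then {i. 3 \<le> i \<and> i \<le> n - 1 \<and> odd i}
           else {1} \<union> {i. 2 \<le> i \<and> i \<le> n - 1 \<and> even i})"

definition V :: "nat \<Rightarrow> (nat \<times> nat) set" where
  "V n = I0 n \<times> {1, 3} \<union> I1 n \<times> {0, 2} \<union> {(n - 1, 4)}"

text \<open>
  The indeterminate \<open>i\<^sub>a\<close> is encoded by the pair \<open>(i, a)\<close>, and a monomial by the multiset
  of its indeterminates.  The product of monomials is \<open>+\<close>, the \<open>k\<close>-th power is
  \<open>repeat_mset k\<close>, and divisibility is \<open>\<subseteq>#\<close>.
\<close>

type_synonym monomial = "(nat \<times> nat) multiset"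

definition monomials :: "nat \<Rightarrow> monomial set" where
  "monomials n = {m. set_mset m \<subseteq> V n}"

definition F :: "nat \<Rightarrow> nat \<Rightarrow> monomial" where
  "F n i = (if i \<in> I0 n then {#(i, 1), (i, 3)#}
            else if i = n - 1 then {#(i, 0), (i, 2), (i, 4)#}
            else {#(i, 0), (i, 2)#})"

definition monomials' :: "nat \<Rightarrow> monomial set" where
  "monomials' n = {m \<in> monomials n. \<forall>i \<in> I_set n. \<not> F n i \<subseteq># m}"

text \<open>
  The fields \<open>exp_a\<close>, \<open>exp_pI\<close>, \<open>exp_qI\<close> hold the families \<open>a\<^sub>i\<close>, \<open>p\<^sub>i\<close>, \<open>q\<^sub>i\<close>;
  the remaining fields hold the single exponents \<open>p, q, r, s, t, u\<close> at the node \<open>n - 1\<close>.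
\<close>

record exponents =
  exp_a :: "nat \<Rightarrow> nat"
  exp_pI :: "nat \<Rightarrow> nat"
  exp_qI :: "nat \<Rightarrow> nat"
  exp_p :: nat
  exp_q :: nat
  exp_r :: nat
  exp_s :: nat
  exp_t :: nat
  exp_u :: nat

definition monomial_of :: "nat \<Rightarrow> exponents \<Rightarrow> monomial" where
  "monomial_of n e =
     (\<Sum>i\<in>I_set n. repeat_mset (exp_a e i) (F n i))
   + (\<Sum>i\<in>I0 n. repeat_mset (exp_pI e i) {#(i, 1)#} + repeat_mset (exp_qI e i) {#(i, 3)#})
   + (\<Sum>j\<in>I1 n - {n - 1}.
        repeat_mset (exp_pI e j) {#(j, 2)#} + repeat_mset (exp_qI e j) {#(j, 0)#})
   + repeat_mset (exp_p e) {#(n - 1, 2), (n - 1, 4)#}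
   + repeat_mset (exp_q e) {#(n - 1, 0), (n - 1, 4)#}
   + repeat_mset (exp_r e) {#(n - 1, 0), (n - 1, 2)#}
   + repeat_mset (exp_s e) {#(n - 1, 0)#}
   + repeat_mset (exp_t e) {#(n - 1, 2)#}
   + repeat_mset (exp_u e) {#(n - 1, 4)#}"

definition at_most_one_nonzero :: "nat list \<Rightarrow> bool" where
  "at_most_one_nonzero xs \<longleftrightarrow> length (filter (\<lambda>x. x \<noteq> 0) xs) \<le> 1"

text \<open>
  The families of exponents are total functions on \<open>nat\<close>; the first two conditions fix
  their irrelevant values outside the index sets, so that uniqueness of the exponents
  makes sense as equality of records.
\<close>

definition reduced :: "nat \<Rightarrow> exponents \<Rightarrow> bool" where
  "reduced n e \<longleftrightarrow>
     (\<forall>i. i \<notin> I_set n \<longrightarrow> exp_a e i = 0)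
   \<and> (\<forall>i. i \<notin> I_set n - {n - 1} \<longrightarrow> exp_pI e i = 0 \<and> exp_qI e i = 0)
   \<and> (\<forall>i \<in> I_set n - {n - 1}. at_most_one_nonzero [exp_pI e i, exp_qI e i])
   \<and> at_most_one_nonzero [exp_p e, exp_q e, exp_r e]
   \<and> at_most_one_nonzero [exp_s e, exp_t e, exp_u e]
   \<and> at_most_one_nonzero [exp_p e, exp_s e]
   \<and> at_most_one_nonzero [exp_q e, exp_t e]
   \<and> at_most_one_nonzero [exp_r e, exp_u e]"

lemma finite_index: "finite (I_set n)" "finite (I0 n)" "finite (I1 n)"
proof -
  have "I0 n \<subseteq> {0..n} \<union> {1}" "I1 n \<subseteq> {0..n} \<union> {1}"
    by (auto simp: I0_def I1_def)
  then show "finite (I_set n)" "finite (I0 n)" "finite (I1 n)"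
    by (auto simp: I_set_def intro: finite_subset)
qed

lemma index_partition:
  assumes "n \<ge> 4"
  shows "I_set n = I0 n \<union> I1 n" "I0 n \<inter> I1 n = {}" "n - 1 \<in> I1 n" "n - 1 \<in> I_set n" "n - 1 \<notin> I0 n"
proof -
  have "i \<in> I_set n \<longleftrightarrow> i \<in> I0 n \<or> i \<in> I1 n" for i
    using assms unfolding I_set_def I0_def I1_def
    by (cases "even n"; simp only: if_True if_False Un_iff mem_Collect_eq singleton_iff atLeastAtMost_iff simp_thms) presburger+
  then show "I_set n = I0 n \<union> I1 n" by blast
  have "\<not> (i \<in> I0 n \<and> i \<in> I1 n)" for i
    using assms unfolding I0_def I1_def
    by (cases "even n"; simp only: if_True if_False Un_iff mem_Collect_eq singleton_iff simp_thms) presburger+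
  then show "I0 n \<inter> I1 n = {}" by blast
  show 3: "n - 1 \<in> I1 n"
    using assms unfolding I1_def
    by (cases "even n"; simp only: if_True if_False Un_iff mem_Collect_eq singleton_iff simp_thms) presburger+
  show "n - 1 \<in> I_set n" using assms by (simp add: I_set_def)
  show "n - 1 \<notin> I0 n" using 3 \<open>I0 n \<inter> I1 n = {}\<close> by blast
qed

lemma sum_fst_delta:
  assumes "finite A" and "\<And>i. i \<noteq> k \<Longrightarrow> f i = (0::nat)"
  shows "(\<Sum>i\<in>A. f i) = (if k \<in> A then f k else 0)"
proof -
  have "(\<Sum>i\<in>A. f i) = (\<Sum>i\<in>A. if i = k then f k else 0)"
    using assms(2) by (intro sum.cong) auto
  then show ?thesis using assms(1) by simp
qed

lemma count_monomial_of:
  "count (monomial_of n e) (k, b) =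
     (if k \<in> I_set n then exp_a e k * count (F n k) (k, b) else 0)
   + (if k \<in> I0 n then (if b = 1 then exp_pI e k else 0) + (if b = 3 then exp_qI e k else 0) else 0)
   + (if k \<in> I1 n - {n - 1} then (if b = 2 then exp_pI e k else 0) + (if b = 0 then exp_qI e k else 0) else 0)
   + (if k = n - 1 then
        (if b = 0 then exp_q e + exp_r e + exp_s e else 0)
      + (if b = 2 then exp_p e + exp_r e + exp_t e else 0)
      + (if b = 4 then exp_p e + exp_q e + exp_u e else 0) else 0)"
proof -
  have 1: "(\<Sum>i\<in>I_set n. count (repeat_mset (exp_a e i) (F n i)) (k, b))
     = (if k \<in> I_set n then count (repeat_mset (exp_a e k) (F n k)) (k, b) else 0)"
    by (rule sum_fst_delta[OF finite_index(1)]) (auto simp: F_def)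
  have 2: "(\<Sum>i\<in>I0 n. count (repeat_mset (exp_pI e i) {#(i, 1)#} + repeat_mset (exp_qI e i) {#(i, 3)#}) (k, b))
     = (if k \<in> I0 n then count (repeat_mset (exp_pI e k) {#(k, 1)#} + repeat_mset (exp_qI e k) {#(k, 3)#}) (k, b) else 0)"
    by (rule sum_fst_delta[OF finite_index(2)]) auto
  have 3: "(\<Sum>i\<in>I1 n - {n - 1}. count (repeat_mset (exp_pI e i) {#(i, 2)#} + repeat_mset (exp_qI e i) {#(i, 0)#}) (k, b))
     = (if k \<in> I1 n - {n - 1} then count (repeat_mset (exp_pI e k) {#(k, 2)#} + repeat_mset (exp_qI e k) {#(k, 0)#}) (k, b) else 0)"
    by (rule sum_fst_delta) (auto simp: finite_index)
  show ?thesis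
    unfolding monomial_of_def count_union count_sum 1 2 3[unfolded count_union] 2[unfolded count_union]
    by (auto simp del: One_nat_def)
qed

lemma counts:
  assumes n: "n \<ge> 4"
  shows "i \<in> I0 n \<Longrightarrow> count (monomial_of n e) (i, 1) = exp_a e i + exp_pI e i"
    "i \<in> I0 n \<Longrightarrow> count (monomial_of n e) (i, 3) = exp_a e i + exp_qI e i"
    "i \<in> I1 n - {n - 1} \<Longrightarrow> count (monomial_of n e) (i, 2) = exp_a e i + exp_pI e i"
    "i \<in> I1 n - {n - 1} \<Longrightarrow> count (monomial_of n e) (i, 0) = exp_a e i + exp_qI e i"
    "count (monomial_of n e) (n - 1, 0) = exp_a e (n - 1) + exp_q e + exp_r e + exp_s e"
    "count (monomial_of n e) (n - 1, 2) = exp_a e (n - 1) + exp_p e + exp_r e + exp_t e"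
    "count (monomial_of n e) (n - 1, 4) = exp_a e (n - 1) + exp_p e + exp_q e + exp_u e"
    "x \<notin> V n \<Longrightarrow> count (monomial_of n e) x = 0"
  using index_partition[OF n]
  apply (auto simp: count_monomial_of F_def)[7]
  apply (cases x)
  using index_partition[OF n]
  by (auto simp: count_monomial_of F_def V_def)

lemma at_most_one_nonzero_pair: "at_most_one_nonzero [x, y] \<longleftrightarrow> x = 0 \<or> y = 0"
  by (simp add: at_most_one_nonzero_def)

lemma at_most_one_nonzero_triple:
  "at_most_one_nonzero [x, y, z] \<longleftrightarrow> (x = 0 \<and> y = 0) \<or> (x = 0 \<and> z = 0) \<or> (y = 0 \<and> z = 0)"
  by (auto simp: at_most_one_nonzero_def)

lemma triple_det:
  fixes a p q r s t u X Y Z :: nat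
  assumes "X = a + q + r + s" "Y = a + p + r + t" "Z = a + p + q + u"
   and "at_most_one_nonzero [p,q,r]" "at_most_one_nonzero [s,t,u]" "at_most_one_nonzero [p,s]"
     "at_most_one_nonzero [q,t]" "at_most_one_nonzero [r,u]"
  shows "a = min X (min Y Z)" "p = (if X = a then min Y Z - a else 0)"
    "q = (if Y = a then min X Z - a else 0)" "r = (if Z = a then min X Y - a else 0)"
    "s = X - a - q - r" "t = Y - a - p - r" "u = Z - a - p - q"
  using assms(4-8) unfolding assms(1-3) at_most_one_nonzero_pair at_most_one_nonzero_triple
  by (elim disjE conjE; simp)+

lemma triple_unique:
  fixes a p q r s t u a' p' q' r' s' t' u' :: nat
  assumes "a + q + r + s = a' + q' + r' + s'" "a + p + r + t = a' + p' + r' + t'" "a + p + q + u = a' + p' + q' + u'"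
   and "at_most_one_nonzero [p,q,r]" "at_most_one_nonzero [s,t,u]" "at_most_one_nonzero [p,s]"
     "at_most_one_nonzero [q,t]" "at_most_one_nonzero [r,u]"
   and "at_most_one_nonzero [p',q',r']" "at_most_one_nonzero [s',t',u']" "at_most_one_nonzero [p',s']"
     "at_most_one_nonzero [q',t']" "at_most_one_nonzero [r',u']"
 shows "a = a' \<and> p = p' \<and> q = q' \<and> r = r' \<and> s = s' \<and> t = t' \<and> u = u'"
proof -
  note A = triple_det[OF refl refl refl assms(4-8)]
  note B = triple_det[OF assms(1-3) assms(9-13)]
  have a: "a = a'" using A(1) B(1) by (rule trans[OF _ sym])
  have p: "p = p'" by (rule trans[OF A(2) sym[OF B(2)[folded a]]])
  have q: "q = q'" by (rule trans[OF A(3) sym[OF B(3)[folded a]]])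
  have r: "r = r'" by (rule trans[OF A(4) sym[OF B(4)[folded a]]])
  show ?thesis using a p q r assms(1-3) by simp
qed

lemma triple_ex:
  fixes x y z :: nat
  shows "\<exists>a p q r s t u. x = a + q + r + s \<and> y = a + p + r + t \<and> z = a + p + q + u
   \<and> at_most_one_nonzero [p,q,r] \<and> at_most_one_nonzero [s,t,u] \<and> at_most_one_nonzero [p,s]
     \<and> at_most_one_nonzero [q,t] \<and> at_most_one_nonzero [r,u]"
proof -
  consider "x \<le> y" "x \<le> z" | "y \<le> x" "y \<le> z" "x \<noteq> y" | "z \<le> x" "z \<le> y" "x \<noteq> z" "y \<noteq> z"
    by linarith
  then show ?thesis
  proof cases
    case 1 then show ?thesis
      apply -
      apply (rule exI[of _ x], rule exI[of _ "min y z - x"], rule exI[of _ 0], rule exI[of _ 0], rule exI[of _ 0], rule exI[of _ "y - min y z"], rule exI[of _ "z - min y z"])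
      apply (simp add: at_most_one_nonzero_pair at_most_one_nonzero_triple min_def)
      done
  next
    case 2 then show ?thesis
      apply -
      apply (rule exI[of _ y], rule exI[of _ 0], rule exI[of _ "min x z - y"], rule exI[of _ 0], rule exI[of _ "x - min x z"], rule exI[of _ 0], rule exI[of _ "z - min x z"])
      apply (simp add: at_most_one_nonzero_pair at_most_one_nonzero_triple min_def)
      done
  next
    case 3 then show ?thesis
      apply -
      apply (rule exI[of _ z], rule exI[of _ 0], rule exI[of _ 0], rule exI[of _ "min x y - z"], rule exI[of _ "x - min x y"], rule exI[of _ "y - min x y"], rule exI[of _ 0])
      apply (simp add: at_most_one_nonzero_pair at_most_one_nonzero_triple min_def)
      done
  qed
qed

lemma ex1_exponents:
  assumes n: "n \<ge> 4" and m: "m \<in> monomials n"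
  shows "\<exists>!e. reduced n e \<and> m = monomial_of n e"
proof -
  note ip = index_partition[OF n]
  obtain a p q r s t u where tr:
    "count m (n-1,0) = a + q + r + s" "count m (n-1,2) = a + p + r + t" "count m (n-1,4) = a + p + q + u"
    "at_most_one_nonzero [p,q,r]" "at_most_one_nonzero [s,t,u]" "at_most_one_nonzero [p,s]"
    "at_most_one_nonzero [q,t]" "at_most_one_nonzero [r,u]"
    using triple_ex[of "count m (n-1,0)" "count m (n-1,2)" "count m (n-1,4)"] by blast
  define P where "P i = (if i \<in> I0 n then count m (i,1) else if i \<in> I1 n - {n-1} then count m (i,2) else 0)" for i
  define R where "R i = (if i \<in> I0 n then count m (i,3) else if i \<in> I1 n - {n-1} then count m (i,0) else 0)" for i
  define e where "e = \<lparr>exp_a = (\<lambda>i. if i = n - 1 then a else min (P i) (R i)),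
     exp_pI = (\<lambda>i. P i - min (P i) (R i)), exp_qI = (\<lambda>i. R i - min (P i) (R i)),
     exp_p = p, exp_q = q, exp_r = r, exp_s = s, exp_t = t, exp_u = u\<rparr>"
  have red: "reduced n e"
  proof -
    have out: "P i = 0 \<and> R i = 0" if "i \<notin> I_set n - {n - 1}" for i
    proof -
      have "i \<notin> I0 n" "i \<notin> I1 n - {n - 1}" using that ip by blast+
      then show ?thesis unfolding P_def R_def by auto
    qed
    have "exp_a e i = 0" if "i \<notin> I_set n" for i
    proof -
      have "i \<noteq> n - 1" using that ip by blast
      then show ?thesis using out[of i] that by (simp add: e_def)
    qed
    moreover have "exp_pI e i = 0 \<and> exp_qI e i = 0" if "i \<notin> I_set n - {n - 1}" for i
      using out[OF that] by (simp add: e_def)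
    moreover have "at_most_one_nonzero [exp_pI e i, exp_qI e i]" for i
      by (simp add: e_def at_most_one_nonzero_pair min_def)
    ultimately show ?thesis unfolding reduced_def using tr(4-8) by (simp add: e_def)
  qed
  have "count m x = count (monomial_of n e) x" for x
  proof (cases "x \<in> V n")
    case False
    then have "count m x = 0" using m by (auto simp: monomials_def count_eq_zero_iff)
    then show ?thesis using False counts(8)[OF n] by simp
  next
    case True
    then consider i where "i \<in> I0 n" "x = (i,1)" | i where "i \<in> I0 n" "x = (i,3)"
      | j where "j \<in> I1 n - {n-1}" "x = (j,2)" | j where "j \<in> I1 n - {n-1}" "x = (j,0)"
      | "x = (n-1,0)" | "x = (n-1,2)" | "x = (n-1,4)"
      unfolding V_def by (cases x) (auto simp del: One_nat_def)
    then show ?thesis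
    proof cases
      case 1 then show ?thesis using ip unfolding 1(2) counts(1)[OF n 1(1)] by (auto simp: e_def P_def)
    next
      case 2 then show ?thesis using ip unfolding 2(2) counts(2)[OF n 2(1)] by (auto simp: e_def R_def)
    next
      case 3 then show ?thesis using ip unfolding 3(2) counts(3)[OF n 3(1)] by (auto simp: e_def P_def)
    next
      case 4 then show ?thesis using ip unfolding 4(2) counts(4)[OF n 4(1)] by (auto simp: e_def R_def)
    next
      case 5 then show ?thesis using tr unfolding 5 counts(5)[OF n] by (simp add: e_def)
    next
      case 6 then show ?thesis using tr unfolding 6 counts(6)[OF n] by (simp add: e_def)
    next
      case 7 then show ?thesis using tr unfolding 7 counts(7)[OF n] by (simp add: e_def)
    qed
  qed
  then have meq: "m = monomial_of n e" by (rule multiset_eqI)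
  have uniq: "f = g" if f: "reduced n f" "m = monomial_of n f" and g: "reduced n g" "m = monomial_of n g" for f g
  proof -
    have c: "count (monomial_of n f) x = count (monomial_of n g) x" for x using f g by simp
    have T: "exp_a f (n-1) = exp_a g (n-1) \<and> exp_p f = exp_p g \<and> exp_q f = exp_q g \<and> exp_r f = exp_r g
        \<and> exp_s f = exp_s g \<and> exp_t f = exp_t g \<and> exp_u f = exp_u g"
      using c[of "(n-1,0)"] c[of "(n-1,2)"] c[of "(n-1,4)"] f(1) g(1)
      unfolding counts(5-7)[OF n] reduced_def by (intro triple_unique) simp_all
    have O: "exp_a f i = exp_a g i \<and> exp_pI f i = exp_pI g i \<and> exp_qI f i = exp_qI g i" if "i \<noteq> n - 1" for i
    proof (cases "i \<in> I_set n")
      case False then show ?thesis using f g by (simp add: reduced_def)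
    next
      case True
      then have am: "at_most_one_nonzero [exp_pI f i, exp_qI f i]" "at_most_one_nonzero [exp_pI g i, exp_qI g i]"
        using f g that by (auto simp: reduced_def)
      have "exp_a f i + exp_pI f i = exp_a g i + exp_pI g i \<and> exp_a f i + exp_qI f i = exp_a g i + exp_qI g i"
      proof (cases "i \<in> I0 n")
        case True then show ?thesis using c[of "(i,1)"] c[of "(i,3)"] counts(1,2)[OF n True] by simp
      next
        case False
        then have "i \<in> I1 n - {n-1}" using True ip that by auto
        then show ?thesis using c[of "(i,2)"] c[of "(i,0)"] counts(3,4)[OF n \<open>i \<in> I1 n - {n-1}\<close>] by simp
      qed
      then show ?thesis using am unfolding at_most_one_nonzero_pair by linarith
    qed
    have O': "exp_pI f (n-1) = exp_pI g (n-1) \<and> exp_qI f (n-1) = exp_qI g (n-1)"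
      using f g by (simp add: reduced_def)
    have "exp_a f = exp_a g" "exp_pI f = exp_pI g" "exp_qI f = exp_qI g"
      unfolding fun_eq_iff using T O O' by metis+
    then show ?thesis using T by (intro exponents.equality) auto
  qed
  show ?thesis using red meq uniq by blast
qed

text \<open>The description below is justified for \<open>n \<ge> 4\<close> and \<open>m \<in> monomials n\<close> by \<open>ex1_exponents\<close>.\<close>

definition exponents_of :: "nat \<Rightarrow> monomial \<Rightarrow> exponents" where
  "exponents_of n m = (THE e. reduced n e \<and> m = monomial_of n e)"

text \<open>
  The free abelian group on \<open>\<alpha>\<^sub>0, \<dots>, \<alpha>\<^sub>n\<close>, as finitely supported functions
  \<open>nat \<Rightarrow>\<^sub>0 int\<close> with support in \<open>{0..n}\<close>.
\<close>

definition root_lattice :: "nat \<Rightarrow> (nat \<Rightarrow>\<^sub>0 int) set" where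
  "root_lattice n = {x. Poly_Mapping.keys x \<subseteq> {0..n}}"

abbreviation alpha :: "nat \<Rightarrow> (nat \<Rightarrow>\<^sub>0 int)" where
  "alpha i \<equiv> frag_of i"

definition eta :: "nat \<Rightarrow> (nat \<Rightarrow>\<^sub>0 int)" where
  "eta n = (if n = 4 then alpha 1 + alpha 2 + alpha 3 + alpha 4
            else alpha (n - 2) + alpha (n - 1) + alpha n)"

definition G :: "nat \<Rightarrow> monomial \<Rightarrow> (nat \<Rightarrow>\<^sub>0 int)" where
  "G n m = (let e = exponents_of n m in
     (\<Sum>i\<in>I_set n - {n - 1}. frag_cmul (int (exp_qI e i) - int (exp_pI e i)) (alpha i))
   - frag_cmul (int (exp_p e)) (alpha 0)
   + frag_cmul (int (exp_q e)) (alpha 0 + alpha (n - 1) + eta n)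
   + frag_cmul (int (exp_r e)) (alpha 0)
   + frag_cmul (int (exp_s e)) (alpha 0 + alpha (n - 1))
   - frag_cmul (int (exp_t e)) (alpha (n - 1))
   + frag_cmul (int (exp_u e)) (eta n))"

end

theory Submission imports Defs begin

text \<open>
  The map factors through the exponents. A monomial is the same thing as a reduced record of
  exponents, and \<open>exp_a e i\<close> is the number of copies of \<open>F n i\<close> that the monomial contains, so
  \<open>monomials' n\<close> corresponds to the reduced records with \<open>exp_a e = 0\<close>
  (\<open>bij_betw_exponents_of\<close>). It remains to see that such a record can be recovered from its
  weight, and that every weight occurs (\<open>bij_betw_weight\<close>).

  Only the exponents at the node \<open>n - 1\<close> contribute to the coefficients \<open>A\<close> of \<open>\<alpha>\<^sub>0\<close> and \<open>B\<close> of
  \<open>\<alpha>\<^sub>n\<^sub>-\<^sub>1\<close>, since \<open>\<eta>\<close> has coefficient 0 at the former and 1 at the latter. Hence \<open>p, q, r, s, t, u\<close>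
  contribute multiples of the plane vectors \<open>(-1,0), (1,2), (1,0), (1,1), (0,-1), (0,1)\<close> to
  \<open>(A, B)\<close>. The conditions on zero exponents allow exactly the pairs of neighbouring vectors in the
  cyclic order \<open>(1,0), (1,1), (1,2), (0,1), (-1,0), (0,-1)\<close>. Each such pair is a
  basis of the lattice \<open>\<int>\<^sup>2\<close>, and the six cones they span form a complete fan, so every
  \<open>(A, B)\<close> arises from exactly one choice of the six exponents (\<open>plane_fan\<close>).

  Once these are known, so is the total coefficient \<open>q + u\<close> of \<open>\<eta>\<close>. Subtracting
  its contribution from the coefficient of another \<open>\<alpha>\<^sub>i\<close> leaves \<open>q\<^sub>i - p\<^sub>i\<close>, an arbitrary integer
  that determines \<open>q\<^sub>i\<close> and \<open>p\<^sub>i\<close> as its positive and negative parts.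
\<close>

section \<open>Monomials and reduced exponents\<close>

lemma monomial_of_in_monomials:
  assumes "n \<ge> 4"
  shows "monomial_of n e \<in> monomials n"
  unfolding monomials_def mem_Collect_eq
proof
  fix x assume "x \<in># monomial_of n e"
  then show "x \<in> V n"
    using counts(8)[OF assms, of x e] by (metis not_in_iff)
qed

lemma exponents_of_monomial_of:
  assumes "n \<ge> 4" "reduced n e"
  shows "exponents_of n (monomial_of n e) = e"
  unfolding exponents_of_def
  by (rule the1_equality[OF ex1_exponents[OF assms(1) monomial_of_in_monomials[OF assms(1)]]])
    (use assms(2) in simp)

lemma exponents_of_props:
  assumes "n \<ge> 4" "m \<in> monomials n"
  shows reduced_exponents_of: "reduced n (exponents_of n m)"
    and monomial_of_exponents_of: "monomial_of n (exponents_of n m) = m"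
  using theI'[OF ex1_exponents[OF assms]] unfolding exponents_of_def by auto

text \<open>
  Removing all copies of \<open>F n i\<close> leaves a product of generators in which some factor of \<open>F n i\<close>
  is absent, precisely because of the conditions on zero exponents.
\<close>

lemma F_dvd_monomial_of_iff:
  assumes n: "n \<ge> 4" and e: "reduced n e" and i: "i \<in> I_set n"
  shows "F n i \<subseteq># monomial_of n e \<longleftrightarrow> exp_a e i \<noteq> 0"
proof -
  note ip = index_partition[OF n]
  let ?c = "\<lambda>b. count (monomial_of n e) (i, b)"
  consider "i \<in> I0 n" | "i \<in> I1 n - {n - 1}" "i \<notin> I0 n" | "i = n - 1"
    using i ip by blast
  then show ?thesis
  proof cases
    case 1
    have "F n i \<subseteq># monomial_of n e \<longleftrightarrow> ?c 1 \<ge> 1 \<and> ?c 3 \<ge> 1"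
      using 1 by (auto simp: F_def insert_subset_eq_iff in_diff_count Suc_le_eq)
    moreover have "exp_pI e i = 0 \<or> exp_qI e i = 0"
    proof -
      have "i \<in> I_set n - {n - 1}" using i 1 ip(5) by blast
      then have "at_most_one_nonzero [exp_pI e i, exp_qI e i]"
        using e unfolding reduced_def by blast
      then show ?thesis by (simp only: at_most_one_nonzero_pair)
    qed
    ultimately show ?thesis
      unfolding counts(1,2)[OF n 1] by auto
  next
    case 2
    have "F n i \<subseteq># monomial_of n e \<longleftrightarrow> ?c 0 \<ge> 1 \<and> ?c 2 \<ge> 1"
      using 2 by (auto simp: F_def insert_subset_eq_iff in_diff_count Suc_le_eq)
    moreover have "exp_pI e i = 0 \<or> exp_qI e i = 0"
    proof -
      have "i \<in> I_set n - {n - 1}" using i 2 by blast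
      then have "at_most_one_nonzero [exp_pI e i, exp_qI e i]"
        using e unfolding reduced_def by blast
      then show ?thesis by (simp only: at_most_one_nonzero_pair)
    qed
    ultimately show ?thesis
      unfolding counts(3,4)[OF n 2(1)] by auto
  next
    case 3
    have "F n i \<subseteq># monomial_of n e \<longleftrightarrow> ?c 0 \<ge> 1 \<and> ?c 2 \<ge> 1 \<and> ?c 4 \<ge> 1"
      unfolding 3 using ip(5) by (auto simp: F_def insert_subset_eq_iff in_diff_count Suc_le_eq)
    moreover have "exp_q e + exp_r e + exp_s e = 0 \<or> exp_p e + exp_r e + exp_t e = 0
        \<or> exp_p e + exp_q e + exp_u e = 0"
    proof -
      have "at_most_one_nonzero [exp_p e, exp_q e, exp_r e]"
        "at_most_one_nonzero [exp_s e, exp_t e, exp_u e]"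
        "at_most_one_nonzero [exp_p e, exp_s e]" "at_most_one_nonzero [exp_q e, exp_t e]"
        "at_most_one_nonzero [exp_r e, exp_u e]"
        using e unfolding reduced_def by blast+
      then show ?thesis
        unfolding at_most_one_nonzero_pair at_most_one_nonzero_triple add_is_0 by blast
    qed
    ultimately show ?thesis
      unfolding 3 counts(5-7)[OF n] by linarith
  qed
qed

definition F_free_exponents :: "nat \<Rightarrow> exponents set" where
  "F_free_exponents n = {e. reduced n e \<and> exp_a e = (\<lambda>_. 0)}"

lemma monomial_of_in_monomials'_iff:
  assumes n: "n \<ge> 4" and e: "reduced n e"
  shows "monomial_of n e \<in> monomials' n \<longleftrightarrow> e \<in> F_free_exponents n"
proof -
  have "(\<forall>i\<in>I_set n. exp_a e i = 0) \<longleftrightarrow> exp_a e = (\<lambda>_. 0)"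
    using e by (auto simp: reduced_def fun_eq_iff)
  then show ?thesis
    using F_dvd_monomial_of_iff[OF n e] e monomial_of_in_monomials[OF n, of e]
    by (auto simp: monomials'_def F_free_exponents_def)
qed

lemma bij_betw_exponents_of:
  assumes n: "n \<ge> 4"
  shows "bij_betw (exponents_of n) (monomials' n) (F_free_exponents n)"
proof (rule bij_betw_byWitness[where f' = "monomial_of n"])
  have m: "m \<in> monomials n" if "m \<in> monomials' n" for m
    using that by (simp add: monomials'_def)
  show "\<forall>m\<in>monomials' n. monomial_of n (exponents_of n m) = m"
    using monomial_of_exponents_of[OF n m] by blast
  show "\<forall>e\<in>F_free_exponents n. exponents_of n (monomial_of n e) = e"
    using exponents_of_monomial_of[OF n] by (simp add: F_free_exponents_def)
  show "exponents_of n ` monomials' n \<subseteq> F_free_exponents n"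
    using monomial_of_in_monomials'_iff[OF n reduced_exponents_of[OF n m]]
      monomial_of_exponents_of[OF n m] by auto
  show "monomial_of n ` F_free_exponents n \<subseteq> monomials' n"
    using monomial_of_in_monomials'_iff[OF n] by (auto simp: F_free_exponents_def)
qed

section \<open>The fan at the exceptional node\<close>

text \<open>
  On each of the six cones the formulas for \<open>p, \<dots>, u\<close> are the coordinates with respect to the two
  generators of that cone: the arguments of \<open>nat\<close> that belong to the other generators are
  nonpositive there. For example \<open>q = B - A\<close> and \<open>s = 2 * A - B\<close> are the only nonzero values when
  \<open>A \<le> B \<le> 2 * A\<close>.
\<close>

lemma plane_fan:
  fixes p q r s t u :: nat and A B :: int
  shows "at_most_one_nonzero [p, q, r] \<and> at_most_one_nonzero [s, t, u]
      \<and> at_most_one_nonzero [p, s] \<and> at_most_one_nonzero [q, t] \<and> at_most_one_nonzero [r, u]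
      \<and> - int p + int q + int r + int s = A \<and> 2 * int q + int s - int t + int u = B
    \<longleftrightarrow> p = nat (- A) \<and> q = nat (min A (B - A)) \<and> r = nat (min A (A - B))
      \<and> s = nat (min B (2 * A - B)) \<and> t = nat (- B) \<and> u = nat (min B (B - 2 * A))"
    (is "?L \<longleftrightarrow> ?R")
proof
  assume ?L
  then show ?R
    unfolding at_most_one_nonzero_pair at_most_one_nonzero_triple
    by (elim conjE disjE; hypsubst) simp_all
next
  assume R: ?R
  consider "A \<le> 0" "B \<le> 0" | "A \<le> 0" "0 \<le> B" | "0 \<le> A" "B \<le> 0"
    | "0 \<le> B" "B \<le> A" | "A \<le> B" "B \<le> 2 * A" | "0 \<le> A" "2 * A \<le> B"
    by linarith
  then show ?L
    using R unfolding at_most_one_nonzero_pair at_most_one_nonzero_triple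
    by cases simp_all
qed

section \<open>Recovering the exponents from the weight\<close>

definition weight :: "nat \<Rightarrow> exponents \<Rightarrow> (nat \<Rightarrow>\<^sub>0 int)" where
  "weight n e =
     (\<Sum>i\<in>I_set n - {n - 1}. frag_cmul (int (exp_qI e i) - int (exp_pI e i)) (alpha i))
   - frag_cmul (int (exp_p e)) (alpha 0)
   + frag_cmul (int (exp_q e)) (alpha 0 + alpha (n - 1) + eta n)
   + frag_cmul (int (exp_r e)) (alpha 0)
   + frag_cmul (int (exp_s e)) (alpha 0 + alpha (n - 1))
   - frag_cmul (int (exp_t e)) (alpha (n - 1))
   + frag_cmul (int (exp_u e)) (eta n)"

lemma G_eq_weight: "G n m = weight n (exponents_of n m)"
  by (simp add: G_def weight_def Let_def)

lemma lookup_alpha: "Poly_Mapping.lookup (alpha i) k = (if k = i then 1 else 0)"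
  by (simp add: lookup_single when_def del: single_one)

lemma lookup_eta:
  assumes "n \<ge> 4"
  shows "Poly_Mapping.lookup (eta n) 0 = 0"
    and "Poly_Mapping.lookup (eta n) (n - 1) = 1"
    and "k > n \<Longrightarrow> Poly_Mapping.lookup (eta n) k = 0"
  using assms by (auto simp: eta_def lookup_add lookup_alpha simp del: single_one)

lemma lookup_weight:
  "Poly_Mapping.lookup (weight n e) k =
     (if k \<in> I_set n - {n - 1} then int (exp_qI e k) - int (exp_pI e k) else 0)
   + (if k = 0 then - int (exp_p e) + int (exp_q e) + int (exp_r e) + int (exp_s e) else 0)
   + (if k = n - 1 then int (exp_q e) + int (exp_s e) - int (exp_t e) else 0)
   + (int (exp_q e) + int (exp_u e)) * Poly_Mapping.lookup (eta n) k"
proof -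
  have "Poly_Mapping.lookup
      (\<Sum>i\<in>I_set n - {n - 1}. frag_cmul (int (exp_qI e i) - int (exp_pI e i)) (alpha i)) k
    = (\<Sum>i\<in>I_set n - {n - 1}. if k = i then int (exp_qI e i) - int (exp_pI e i) else 0)"
    by (simp add: lookup_sum lookup_alpha if_distrib del: single_one cong: if_cong)
  then show ?thesis
    by (simp add: weight_def lookup_add lookup_minus lookup_alpha finite_index algebra_simps
        del: One_nat_def single_one)
qed

lemma lookup_weight_cases:
  assumes n: "n \<ge> 4"
  shows "Poly_Mapping.lookup (weight n e) 0
      = - int (exp_p e) + int (exp_q e) + int (exp_r e) + int (exp_s e)"
    and "Poly_Mapping.lookup (weight n e) (n - 1)
      = 2 * int (exp_q e) + int (exp_s e) - int (exp_t e) + int (exp_u e)"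
    and "k \<in> I_set n - {n - 1} \<Longrightarrow> Poly_Mapping.lookup (weight n e) k
      = int (exp_qI e k) - int (exp_pI e k)
        + (int (exp_q e) + int (exp_u e)) * Poly_Mapping.lookup (eta n) k"
    and "k > n \<Longrightarrow> Poly_Mapping.lookup (weight n e) k = 0"
  using n lookup_eta[OF n] by (auto simp: lookup_weight I_set_def)

lemma in_root_lattice_iff:
  "x \<in> root_lattice n \<longleftrightarrow> (\<forall>k>n. Poly_Mapping.lookup x k = 0)"
  unfolding root_lattice_def mem_Collect_eq subset_eq Ball_def atLeastAtMost_iff in_keys_iff
  by (metis le0 not_le)

text \<open>
  The inverse of \<open>weight n\<close>: the six exponents at the node \<open>n - 1\<close> come from \<open>plane_fan\<close>, and
  \<open>d i\<close> is what remains of the coefficient of \<open>\<alpha>\<^sub>i\<close> without the multiple \<open>q + u\<close> of \<open>\<eta>\<close>.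
\<close>

definition exponents_of_weight :: "nat \<Rightarrow> (nat \<Rightarrow>\<^sub>0 int) \<Rightarrow> exponents" where
  "exponents_of_weight n x =
    (let A = Poly_Mapping.lookup x 0;
         B = Poly_Mapping.lookup x (n - 1);
         q = nat (min A (B - A));
         u = nat (min B (B - 2 * A));
         d = (\<lambda>i. if i \<in> I_set n - {n - 1}
                  then Poly_Mapping.lookup x i - (int q + int u) * Poly_Mapping.lookup (eta n) i
                  else 0)
     in \<lparr>exp_a = (\<lambda>_. 0), exp_pI = (\<lambda>i. nat (- d i)), exp_qI = (\<lambda>i. nat (d i)),
         exp_p = nat (- A), exp_q = q, exp_r = nat (min A (A - B)),
         exp_s = nat (min B (2 * A - B)), exp_t = nat (- B), exp_u = u\<rparr>)"

lemma exponents_of_weight_simps: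
  fixes x :: "nat \<Rightarrow>\<^sub>0 int" and n :: nat
  defines "e \<equiv> exponents_of_weight n x"
    and "A \<equiv> Poly_Mapping.lookup x 0" and "B \<equiv> Poly_Mapping.lookup x (n - 1)"
  shows "exp_p e = nat (- A) \<and> exp_q e = nat (min A (B - A)) \<and> exp_r e = nat (min A (A - B))
      \<and> exp_s e = nat (min B (2 * A - B)) \<and> exp_t e = nat (- B)
      \<and> exp_u e = nat (min B (B - 2 * A))"
    and "exp_a e = (\<lambda>_. 0)"
    and "i \<notin> I_set n - {n - 1} \<Longrightarrow> exp_pI e i = 0 \<and> exp_qI e i = 0"
    and "i \<in> I_set n - {n - 1} \<Longrightarrow> exp_pI e i = nat (- (Poly_Mapping.lookup x i
        - (int (exp_q e) + int (exp_u e)) * Poly_Mapping.lookup (eta n) i))"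
    and "i \<in> I_set n - {n - 1} \<Longrightarrow> exp_qI e i = nat (Poly_Mapping.lookup x i
        - (int (exp_q e) + int (exp_u e)) * Poly_Mapping.lookup (eta n) i)"
  unfolding e_def A_def B_def exponents_of_weight_def Let_def exponents.simps
  by (simp_all only: if_True if_False minus_zero nat_0 simp_thms)

text \<open>
  The uniqueness half of \<open>plane_fan\<close> identifies the six exponents at the node \<open>n - 1\<close>. Their
  knowledge gives the multiple of \<open>\<eta>\<close> to be subtracted at the other nodes, where one of the
  two exponents vanishes and their difference therefore determines both.
\<close>

lemma exponents_of_weight_weight:
  assumes n: "n \<ge> 4" and e: "e \<in> F_free_exponents n"
  shows "exponents_of_weight n (weight n e) = e"
proof -
  define f where "f = exponents_of_weight n (weight n e)"
  note f = exponents_of_weight_simps[where n = n and x = "weight n e", folded f_def]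
  have red: "reduced n e" and a: "exp_a e = (\<lambda>_. 0)"
    using e by (auto simp: F_free_exponents_def)
  have am: "at_most_one_nonzero [exp_p e, exp_q e, exp_r e]"
    "at_most_one_nonzero [exp_s e, exp_t e, exp_u e]"
    "at_most_one_nonzero [exp_p e, exp_s e]" "at_most_one_nonzero [exp_q e, exp_t e]"
    "at_most_one_nonzero [exp_r e, exp_u e]"
    using red unfolding reduced_def by blast+
  let ?A = "Poly_Mapping.lookup (weight n e) 0"
  let ?B = "Poly_Mapping.lookup (weight n e) (n - 1)"
  have "exp_p e = nat (- ?A) \<and> exp_q e = nat (min ?A (?B - ?A))
      \<and> exp_r e = nat (min ?A (?A - ?B)) \<and> exp_s e = nat (min ?B (2 * ?A - ?B))
      \<and> exp_t e = nat (- ?B) \<and> exp_u e = nat (min ?B (?B - 2 * ?A))"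
    by (rule iffD1[OF plane_fan])
      (intro conjI am lookup_weight_cases(1,2)[OF n, symmetric])
  then have node: "exp_p e = exp_p f \<and> exp_q e = exp_q f \<and> exp_r e = exp_r f \<and> exp_s e = exp_s f
      \<and> exp_t e = exp_t f \<and> exp_u e = exp_u f"
    by (simp only: f(1) simp_thms)
  have "exp_pI f i = exp_pI e i \<and> exp_qI f i = exp_qI e i" for i
  proof (cases "i \<in> I_set n - {n - 1}")
    case True
    have "Poly_Mapping.lookup (weight n e) i
        - (int (exp_q f) + int (exp_u f)) * Poly_Mapping.lookup (eta n) i
      = int (exp_qI e i) - int (exp_pI e i)"
      using lookup_weight_cases(3)[OF n True, of e] node by simp
    moreover have "at_most_one_nonzero [exp_pI e i, exp_qI e i]"
      using red True unfolding reduced_def by blast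
    ultimately show ?thesis
      using f(4,5)[OF True] unfolding at_most_one_nonzero_pair by auto
  next
    case False
    have "exp_pI e i = 0 \<and> exp_qI e i = 0"
      by (rule red[unfolded reduced_def, THEN conjunct2, THEN conjunct1, THEN spec, THEN mp,
            OF False])
    then show ?thesis using f(3)[OF False] by simp
  qed
  then have "exp_pI f = exp_pI e" "exp_qI f = exp_qI e" by auto
  then show ?thesis
    unfolding f_def[symmetric] using node f(2) a by (intro exponents.equality) simp_all
qed

text \<open>
  The existence half of \<open>plane_fan\<close> shows that the computed exponents at the node \<open>n - 1\<close> are
  admissible and have the right coefficients at \<open>\<alpha>\<^sub>0\<close> and \<open>\<alpha>\<^sub>n\<^sub>-\<^sub>1\<close>.
\<close>

lemma exponents_of_weight_inverse:
  assumes n: "n \<ge> 4"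
  shows exponents_of_weight_F_free: "exponents_of_weight n x \<in> F_free_exponents n"
    and weight_exponents_of_weight:
      "x \<in> root_lattice n \<Longrightarrow> weight n (exponents_of_weight n x) = x"
proof -
  define e where "e = exponents_of_weight n x"
  note e = exponents_of_weight_simps[where n = n and x = x, folded e_def]
  have fan: "at_most_one_nonzero [exp_p e, exp_q e, exp_r e]
      \<and> at_most_one_nonzero [exp_s e, exp_t e, exp_u e]
      \<and> at_most_one_nonzero [exp_p e, exp_s e] \<and> at_most_one_nonzero [exp_q e, exp_t e]
      \<and> at_most_one_nonzero [exp_r e, exp_u e]
      \<and> - int (exp_p e) + int (exp_q e) + int (exp_r e) + int (exp_s e) = Poly_Mapping.lookup x 0
      \<and> 2 * int (exp_q e) + int (exp_s e) - int (exp_t e) + int (exp_u e)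
        = Poly_Mapping.lookup x (n - 1)"
    by (rule iffD2[OF plane_fan e(1)])
  have "at_most_one_nonzero [exp_pI e i, exp_qI e i]" if "i \<in> I_set n - {n - 1}" for i
    using e(4,5)[OF that] unfolding at_most_one_nonzero_pair by linarith
  then show "exponents_of_weight n x \<in> F_free_exponents n"
    using fan e(2,3) by (simp add: F_free_exponents_def reduced_def flip: e_def)
  assume x: "x \<in> root_lattice n"
  have "Poly_Mapping.lookup (weight n e) k = Poly_Mapping.lookup x k" for k
  proof -
    consider "k = 0" | "k = n - 1" | "k \<in> I_set n - {n - 1}" | "k > n"
      unfolding I_set_def by fastforce
    then show ?thesis
    proof cases
      case 1
      then show ?thesis using fan lookup_weight_cases(1)[OF n, of e] by simp
    next
      case 2
      then show ?thesis using fan lookup_weight_cases(2)[OF n, of e] by simp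
    next
      case 3
      then show ?thesis using lookup_weight_cases(3)[OF n 3, of e] e(4,5)[OF 3] by linarith
    next
      case 4
      then show ?thesis using x lookup_weight_cases(4)[OF n 4, of e]
        by (simp add: in_root_lattice_iff)
    qed
  qed
  then show "weight n (exponents_of_weight n x) = x"
    unfolding e_def by (rule poly_mapping_eqI)
qed

lemma bij_betw_weight:
  assumes n: "n \<ge> 4"
  shows "bij_betw (weight n) (F_free_exponents n) (root_lattice n)"
proof (rule bij_betw_byWitness[where f' = "exponents_of_weight n"])
  show "weight n ` F_free_exponents n \<subseteq> root_lattice n"
    using lookup_weight_cases(4)[OF n] by (auto simp: in_root_lattice_iff)
qed (use exponents_of_weight_weight[OF n] exponents_of_weight_inverse[OF n] in auto)

theorem proposition5p2:
  fixes n :: nat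
  assumes "n \<ge> 4"
  shows "bij_betw (G n) (monomials' n) (root_lattice n)"
proof -
  have "G n = weight n \<circ> exponents_of n"
    by (simp add: fun_eq_iff G_eq_weight)
  then show ?thesis
    using bij_betw_trans[OF bij_betw_exponents_of[OF assms] bij_betw_weight[OF assms]] by simp
qed

end
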